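(* Let $m,n$ be distinct square-free rational integers such that $K=\mathbb{Q}(\sqrt{m},\sqrt{n})$ is a quartic number field, let $\mathcal{A}=\mathbb{Z}[\sqrt{m},\sqrt{n}]$, and let $\sigma,\tau$ be any two different non-zero ring endomorphisms of $\mathcal{A}$. Then $\mathcal{A}$ has non-trivial outer $(\sigma,\tau)$-derivations, that is, $\mathrm{Out}_{(\sigma,\tau)}(\mathcal{A})\neq\{0\}$.
   Context: A $(\sigma,\tau)$-derivation of $\mathcal{A}$ is a $\mathbb{Z}$-linear map $D:\mathcal{A}\to\mathcal{A}$ with $D(xy)=D(x)\tau(y)+\sigma(x)D(y)$ for all $x,y\in\mathcal{A}$. It is called inner if there exists $\beta\in\mathcal{A}$ with $D(x)=\beta\tau(x)-\sigma(x)\beta$ for all $x\in\mathcal{A}$. $\mathrm{Out}_{(\sigma,\tau)}(\mathcal{A})$ denotes the quotient of the $\mathbb{Z}$-module of all $(\sigma,\tau)$-derivations of $\mathcal{A}$ by the submodule of inner ones. *)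

theory Defs
  imports
    Complex_Main
    "HOL-Algebra.Generated_Fields"
    "HOL-Algebra.Algebraic_Closure_Type"
    "HOL-Computational_Algebra.Squarefree"
begin

section \<open>Twisted derivations of a ring\<close>

text \<open>Ring endomorphisms need not preserve the unit, so that the zero map is one of them;
  this is why the set \<^term>\<open>ring_hom R R\<close> of unital endomorphisms is not used.\<close>

definition ring_endos :: "('a, 'm) ring_scheme \<Rightarrow> ('a \<Rightarrow> 'a) set" where
  "ring_endos R = hom (add_monoid R) (add_monoid R) \<inter> hom R R"

definition nonzero_on :: "('a, 'm) ring_scheme \<Rightarrow> ('a \<Rightarrow> 'a) \<Rightarrow> bool" where
  "nonzero_on R \<sigma> \<longleftrightarrow> (\<exists>x\<in>carrier R. \<sigma> x \<noteq> \<zero>\<^bsub>R\<^esub>)"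

definition Z_linear_maps :: "('a, 'm) ring_scheme \<Rightarrow> ('a \<Rightarrow> 'a) set" where
  "Z_linear_maps R = {D \<in> carrier R \<rightarrow> carrier R.
     (\<forall>x\<in>carrier R. \<forall>y\<in>carrier R. D (x \<oplus>\<^bsub>R\<^esub> y) = D x \<oplus>\<^bsub>R\<^esub> D y) \<and>
     (\<forall>k::int. \<forall>x\<in>carrier R. D ([k] \<cdot>\<^bsub>R\<^esub> x) = [k] \<cdot>\<^bsub>R\<^esub> D x)}"

text \<open>Maps on the ring are represented by functions that are \<^term>\<open>undefined\<close> outside
  the carrier, so that equality of derivations is equality on the carrier.\<close>

definition twisted_derivations ::
  "('a, 'm) ring_scheme \<Rightarrow> ('a \<Rightarrow> 'a) \<Rightarrow> ('a \<Rightarrow> 'a) \<Rightarrow> ('a \<Rightarrow> 'a) set" where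
  "twisted_derivations R \<sigma> \<tau> = {D \<in> Z_linear_maps R \<inter> extensional (carrier R).
     \<forall>x\<in>carrier R. \<forall>y\<in>carrier R.
       D (x \<otimes>\<^bsub>R\<^esub> y) = (D x \<otimes>\<^bsub>R\<^esub> \<tau> y) \<oplus>\<^bsub>R\<^esub> (\<sigma> x \<otimes>\<^bsub>R\<^esub> D y)}"

definition inner_derivations ::
  "('a, 'm) ring_scheme \<Rightarrow> ('a \<Rightarrow> 'a) \<Rightarrow> ('a \<Rightarrow> 'a) \<Rightarrow> ('a \<Rightarrow> 'a) set" where
  "inner_derivations R \<sigma> \<tau> = {D \<in> twisted_derivations R \<sigma> \<tau>.
     \<exists>\<beta>\<in>carrier R. \<forall>x\<in>carrier R. D x = (\<beta> \<otimes>\<^bsub>R\<^esub> \<tau> x) \<ominus>\<^bsub>R\<^esub> (\<sigma> x \<otimes>\<^bsub>R\<^esub> \<beta>)}"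

text \<open>A module over the integers is the same thing as an abelian group; the module of
  derivations (under pointwise operations) and its quotient are given as such.\<close>

definition derivation_group ::
  "('a, 'm) ring_scheme \<Rightarrow> ('a \<Rightarrow> 'a) \<Rightarrow> ('a \<Rightarrow> 'a) \<Rightarrow> ('a \<Rightarrow> 'a) monoid" where
  "derivation_group R \<sigma> \<tau> =
     \<lparr>carrier = twisted_derivations R \<sigma> \<tau>,
      monoid.mult = (\<lambda>D E. \<lambda>x\<in>carrier R. D x \<oplus>\<^bsub>R\<^esub> E x),
      one = (\<lambda>x\<in>carrier R. \<zero>\<^bsub>R\<^esub>)\<rparr>"

definition Out ::
  "('a, 'm) ring_scheme \<Rightarrow> ('a \<Rightarrow> 'a) \<Rightarrow> ('a \<Rightarrow> 'a) \<Rightarrow> ('a \<Rightarrow> 'a) set monoid" where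
  "Out R \<sigma> \<tau> = derivation_group R \<sigma> \<tau> Mod inner_derivations R \<sigma> \<tau>"

context ring
begin

lemma Z_linear_maps_iff_additive:
  "D \<in> Z_linear_maps R \<longleftrightarrow> D \<in> hom (add_monoid R) (add_monoid R)"
proof
  assume "D \<in> hom (add_monoid R) (add_monoid R)"
  moreover from this have "D ([k] \<cdot> x) = [k] \<cdot> D x" if "x \<in> carrier R" for k :: int and x
    unfolding add_pow_def
    using that group_hom.hom_int_pow[of "add_monoid R" "add_monoid R" D x k]
    by (simp add: group_hom_def group_hom_axioms_def add.is_group)
  ultimately show "D \<in> Z_linear_maps R"
    by (auto simp: Z_linear_maps_def hom_def)
qed (auto simp: Z_linear_maps_def hom_def)

lemma twisted_derivations_iff:
  fixes \<sigma> \<tau> :: "'a \<Rightarrow> 'a"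
  shows "D \<in> twisted_derivations R \<sigma> \<tau> \<longleftrightarrow>
     D \<in> carrier R \<rightarrow>\<^sub>E carrier R \<and>
     (\<forall>x\<in>carrier R. \<forall>y\<in>carrier R. D (x \<oplus> y) = D x \<oplus> D y) \<and>
     (\<forall>x\<in>carrier R. \<forall>y\<in>carrier R. D (x \<otimes> y) = (D x \<otimes> \<tau> y) \<oplus> (\<sigma> x \<otimes> D y))"
  by (auto simp: twisted_derivations_def Z_linear_maps_iff_additive hom_def PiE_def)

lemma derivation_group_comm_group:
  fixes \<sigma> \<tau> :: "'a \<Rightarrow> 'a"
  assumes "\<sigma> \<in> carrier R \<rightarrow> carrier R" "\<tau> \<in> carrier R \<rightarrow> carrier R"
  shows "comm_group (derivation_group R \<sigma> \<tau>)"
proof (rule comm_groupI)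
  note [simp] = derivation_group_def
  have cl: "\<sigma> x \<in> carrier R" "\<tau> x \<in> carrier R" if "x \<in> carrier R" for x
    using assms that by auto
  note sr = l_distr r_distr a_ac l_minus r_minus minus_add
  show "\<one>\<^bsub>derivation_group R \<sigma> \<tau>\<^esub> \<in> carrier (derivation_group R \<sigma> \<tau>)"
    by (auto simp: twisted_derivations_iff cl)
  fix D assume D: "D \<in> carrier (derivation_group R \<sigma> \<tau>)"
  hence Dc: "D x \<in> carrier R" if "x \<in> carrier R" for x
    using that by (auto simp: twisted_derivations_iff)
  have Dext: "D \<in> extensional (carrier R)"
    using D by (auto simp: twisted_derivations_iff PiE_def)
  show "\<one>\<^bsub>derivation_group R \<sigma> \<tau>\<^esub> \<otimes>\<^bsub>derivation_group R \<sigma> \<tau>\<^esub> D = D"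
    by (intro extensionalityI[OF _ Dext]) (auto simp: Dc)
  have "(\<lambda>x\<in>carrier R. \<ominus> D x) \<in> twisted_derivations R \<sigma> \<tau>"
    using D unfolding twisted_derivations_iff
    by (auto simp: twisted_derivations_iff Dc cl sr)
  moreover have "(\<lambda>x\<in>carrier R. (\<lambda>x\<in>carrier R. \<ominus> D x) x \<oplus> D x) = (\<lambda>x\<in>carrier R. \<zero>)"
    by (intro extensionalityI[of _ "carrier R"]) (auto simp: Dc l_neg)
  ultimately show "\<exists>E\<in>carrier (derivation_group R \<sigma> \<tau>).
      E \<otimes>\<^bsub>derivation_group R \<sigma> \<tau>\<^esub> D = \<one>\<^bsub>derivation_group R \<sigma> \<tau>\<^esub>"
    by (simp only: derivation_group_def partial_object.simps monoid.simps) blast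
  fix E assume E: "E \<in> carrier (derivation_group R \<sigma> \<tau>)"
  hence Ec: "E x \<in> carrier R" if "x \<in> carrier R" for x
    using that by (auto simp: twisted_derivations_iff)
  show "D \<otimes>\<^bsub>derivation_group R \<sigma> \<tau>\<^esub> E \<in> carrier (derivation_group R \<sigma> \<tau>)"
    using D E by (auto simp: twisted_derivations_iff Dc Ec cl sr)
  show "D \<otimes>\<^bsub>derivation_group R \<sigma> \<tau>\<^esub> E = E \<otimes>\<^bsub>derivation_group R \<sigma> \<tau>\<^esub> D"
    by (intro extensionalityI[of _ "carrier R"]) (auto simp: Dc Ec a_ac)
  fix F assume F: "F \<in> carrier (derivation_group R \<sigma> \<tau>)"
  hence Fc: "F x \<in> carrier R" if "x \<in> carrier R" for x
    using that by (auto simp: twisted_derivations_iff)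
  show "D \<otimes>\<^bsub>derivation_group R \<sigma> \<tau>\<^esub> E \<otimes>\<^bsub>derivation_group R \<sigma> \<tau>\<^esub> F
      = D \<otimes>\<^bsub>derivation_group R \<sigma> \<tau>\<^esub> (E \<otimes>\<^bsub>derivation_group R \<sigma> \<tau>\<^esub> F)"
    by (intro extensionalityI[of _ "carrier R"]) (auto simp: Dc Ec Fc a_ac)
qed

lemma inner_derivations_subgroup:
  fixes \<sigma> \<tau> :: "'a \<Rightarrow> 'a"
  assumes "\<sigma> \<in> carrier R \<rightarrow> carrier R" "\<tau> \<in> carrier R \<rightarrow> carrier R"
  shows "subgroup (inner_derivations R \<sigma> \<tau>) (derivation_group R \<sigma> \<tau>)"
proof -
  interpret G: comm_group "derivation_group R \<sigma> \<tau>"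
    using derivation_group_comm_group[OF assms] .
  have cl: "\<sigma> x \<in> carrier R" "\<tau> x \<in> carrier R" if "x \<in> carrier R" for x
    using assms that by auto
  note sr = l_distr r_distr a_ac l_minus r_minus minus_add a_minus_def
  show ?thesis
  proof (rule G.subgroupI)
    show "inner_derivations R \<sigma> \<tau> \<subseteq> carrier (derivation_group R \<sigma> \<tau>)"
      by (auto simp: inner_derivations_def derivation_group_def)
    have "\<one>\<^bsub>derivation_group R \<sigma> \<tau>\<^esub> \<in> inner_derivations R \<sigma> \<tau>"
      using G.one_closed
      by (auto simp: inner_derivations_def derivation_group_def cl sr intro!: bexI[of _ "\<zero>"])
    thus "inner_derivations R \<sigma> \<tau> \<noteq> {}" by auto
  next
    fix D assume D: "D \<in> inner_derivations R \<sigma> \<tau>"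
    then obtain b where b: "b \<in> carrier R" "\<forall>x\<in>carrier R. D x = b \<otimes> \<tau> x \<ominus> \<sigma> x \<otimes> b"
      by (auto simp: inner_derivations_def)
    have DG: "D \<in> carrier (derivation_group R \<sigma> \<tau>)"
      using D by (auto simp: inner_derivations_def derivation_group_def)
    define E where "E = inv\<^bsub>derivation_group R \<sigma> \<tau>\<^esub> D"
    have EG: "E \<in> carrier (derivation_group R \<sigma> \<tau>)" using DG by (simp add: E_def)
    have "E \<otimes>\<^bsub>derivation_group R \<sigma> \<tau>\<^esub> D = \<one>\<^bsub>derivation_group R \<sigma> \<tau>\<^esub>"
      using DG by (simp add: E_def)
    hence *: "(\<lambda>x\<in>carrier R. E x \<oplus> D x) = (\<lambda>x\<in>carrier R. \<zero>)"
      by (simp add: derivation_group_def)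
    have "E x = (\<ominus> b) \<otimes> \<tau> x \<ominus> \<sigma> x \<otimes> (\<ominus> b)" if x: "x \<in> carrier R" for x
    proof -
      have c: "E x \<in> carrier R" "D x \<in> carrier R"
        using EG DG x by (auto simp: derivation_group_def twisted_derivations_iff)
      have "E x \<oplus> D x = \<zero>" using fun_cong[OF *, of x] x by simp
      hence "E x = \<ominus> D x" using c by (simp add: minus_equality)
      thus ?thesis using b x by (simp add: cl sr)
    qed
    thus "inv\<^bsub>derivation_group R \<sigma> \<tau>\<^esub> D \<in> inner_derivations R \<sigma> \<tau>"
      using EG b(1) unfolding E_def[symmetric] inner_derivations_def
      by (auto simp: derivation_group_def intro!: bexI[of _ "\<ominus> b"])
  next
    fix D E assume D: "D \<in> inner_derivations R \<sigma> \<tau>" and E: "E \<in> inner_derivations R \<sigma> \<tau>"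
    from D obtain b where b: "b \<in> carrier R" "\<forall>x\<in>carrier R. D x = b \<otimes> \<tau> x \<ominus> \<sigma> x \<otimes> b"
      by (auto simp: inner_derivations_def)
    from E obtain c where c: "c \<in> carrier R" "\<forall>x\<in>carrier R. E x = c \<otimes> \<tau> x \<ominus> \<sigma> x \<otimes> c"
      by (auto simp: inner_derivations_def)
    have "D \<otimes>\<^bsub>derivation_group R \<sigma> \<tau>\<^esub> E \<in> carrier (derivation_group R \<sigma> \<tau>)"
      using D E by (intro G.m_closed) (auto simp: inner_derivations_def derivation_group_def)
    thus "D \<otimes>\<^bsub>derivation_group R \<sigma> \<tau>\<^esub> E \<in> inner_derivations R \<sigma> \<tau>"
      using b c by (auto simp: inner_derivations_def derivation_group_def cl sr
          intro!: bexI[of _ "b \<oplus> c"])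
  qed
qed

end


section \<open>Biquadratic number fields inside the complex numbers\<close>

abbreviation complex_ring :: "complex ring" where
  "complex_ring \<equiv> ring_of_type_algebra"

text \<open>The fields and rings below do not depend on the choice of the square roots;
  \<^const>\<open>csqrt\<close> is used because \<open>m\<close> and \<open>n\<close> may be negative.\<close>

definition biquadratic_field :: "int \<Rightarrow> int \<Rightarrow> complex set" where
  "biquadratic_field m n =
     generate_field complex_ring (\<rat> \<union> {csqrt (of_int m), csqrt (of_int n)})"

definition biquadratic_ring :: "int \<Rightarrow> int \<Rightarrow> complex ring" where
  "biquadratic_ring m n = complex_ring
     \<lparr>carrier := generate_ring complex_ring (\<int> \<union> {csqrt (of_int m), csqrt (of_int n)})\<rparr>"

end

theory Submission
  imports Defs
begin

text \<open>
  A nonzero endomorphism of \<open>\<int>[\<surd>m, \<surd>n]\<close> fixes \<open>\<int>\<close> and maps each of the two square roots to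
  itself or to its negative. Hence all values of \<open>\<tau> - \<sigma>\<close> are divisible by 2 in the ring, and
  \<open>D = (\<tau> - \<sigma>)/2\<close> is a twisted derivation. If it were inner, given by \<open>\<beta>\<close>, then evaluating it
  at a point where \<open>\<sigma>\<close> and \<open>\<tau>\<close> differ would show \<open>\<beta> = 1/2\<close>; but \<open>1/2\<close> is not in the ring.
\<close>

section \<open>Non-trivial classes in the quotient group of derivations\<close>

text \<open>If the quotient had only its neutral element, the coset of \<open>D\<close> would be the
  subgroup of inner derivations itself; but \<open>D\<close> lies in its own coset.\<close>

lemma (in ring) Out_nontrivial:
  fixes \<sigma> \<tau> :: "'a \<Rightarrow> 'a"
  assumes "\<sigma> \<in> carrier R \<rightarrow> carrier R" "\<tau> \<in> carrier R \<rightarrow> carrier R"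
    and D: "D \<in> twisted_derivations R \<sigma> \<tau>" "D \<notin> inner_derivations R \<sigma> \<tau>"
  shows "carrier (Out R \<sigma> \<tau>) \<noteq> {\<one>\<^bsub>Out R \<sigma> \<tau>\<^esub>}"
proof
  let ?G = "derivation_group R \<sigma> \<tau>" and ?I = "inner_derivations R \<sigma> \<tau>"
  interpret G: comm_group ?G
    using derivation_group_comm_group[OF assms(1,2)] .
  have I: "subgroup ?I ?G"
    using inner_derivations_subgroup[OF assms(1,2)] .
  have DG: "D \<in> carrier ?G"
    using D(1) by (simp add: derivation_group_def)
  assume "carrier (Out R \<sigma> \<tau>) = {\<one>\<^bsub>Out R \<sigma> \<tau>\<^esub>}"
  hence "?I #>\<^bsub>?G\<^esub> D = ?I"
    using DG by (auto simp: Out_def carrier_FactGroup)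
  with G.rcos_self[OF DG I] D(2) show False by simp
qed

section \<open>Transfer of the record operations to complex arithmetic, and induction over the
  generators\<close>

lemma complex_ring_simps [simp]:
  "carrier complex_ring = UNIV" "\<one>\<^bsub>complex_ring\<^esub> = 1" "\<zero>\<^bsub>complex_ring\<^esub> = 0"
  "x \<oplus>\<^bsub>complex_ring\<^esub> y = x + y" "x \<otimes>\<^bsub>complex_ring\<^esub> y = x * y"
  by (simp_all add: ring_of_type_algebra_def)

lemma complex_ring_uminus [simp]: "\<ominus>\<^bsub>complex_ring\<^esub> x = - x"
proof -
  interpret ring complex_ring by (rule ring_from_type_algebra)
  show ?thesis by (rule minus_equality) simp_all
qed

lemma biquadratic_ring_simps [simp]:
  "\<one>\<^bsub>biquadratic_ring m n\<^esub> = 1" "\<zero>\<^bsub>biquadratic_ring m n\<^esub> = 0"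
  "x \<oplus>\<^bsub>biquadratic_ring m n\<^esub> y = x + y" "x \<otimes>\<^bsub>biquadratic_ring m n\<^esub> y = x * y"
  by (simp_all add: biquadratic_ring_def)

lemma ring_biquadratic_ring: "ring (biquadratic_ring m n)"
  unfolding biquadratic_ring_def
  by (rule ring.generate_ring_is_ring[OF ring_from_type_algebra]) simp

text \<open>Additive inverses are defined relative to the carrier, so subtraction is identified only
  on it: both sides give \<open>x\<close> when \<open>y\<close> is added back. The simp rules are
  removed in the first step so that the abstract ring laws still match.\<close>

lemma biquadratic_ring_minus:
  assumes "x \<in> carrier (biquadratic_ring m n)" "y \<in> carrier (biquadratic_ring m n)"
  shows "x \<ominus>\<^bsub>biquadratic_ring m n\<^esub> y = x - y"
proof -
  interpret R: ring "biquadratic_ring m n" by (rule ring_biquadratic_ring)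
  have "(x \<ominus>\<^bsub>biquadratic_ring m n\<^esub> y) \<oplus>\<^bsub>biquadratic_ring m n\<^esub> y = x"
    using assms by (simp add: R.minus_eq R.a_assoc R.l_neg del: biquadratic_ring_simps)
  thus ?thesis by (simp add: eq_diff_eq)
qed

text \<open>This is induction over \<open>generate_ring\<close> with the generators split into
  integers and the two roots; the unit is absorbed into the integer case. Membership is kept in the
  later cases because endomorphisms are additive and multiplicative only on the carrier.\<close>

lemma biquadratic_ring_induct [consumes 1, case_names int sqrt1 sqrt2 add uminus mult]:
  assumes "x \<in> carrier (biquadratic_ring m n)"
    and "\<And>k::int. P (of_int k)" "P (csqrt (of_int m))" "P (csqrt (of_int n))"
    and "\<And>x y. \<lbrakk>x \<in> carrier (biquadratic_ring m n); P x;
      y \<in> carrier (biquadratic_ring m n); P y\<rbrakk> \<Longrightarrow> P (x + y)"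
    and "\<And>x. \<lbrakk>x \<in> carrier (biquadratic_ring m n); P x\<rbrakk> \<Longrightarrow> P (- x)"
    and "\<And>x y. \<lbrakk>x \<in> carrier (biquadratic_ring m n); P x;
      y \<in> carrier (biquadratic_ring m n); P y\<rbrakk> \<Longrightarrow> P (x * y)"
  shows "P x"
proof -
  have "x \<in> generate_ring complex_ring (\<int> \<union> {csqrt (of_int m), csqrt (of_int n)})"
    using assms(1) by (simp add: biquadratic_ring_def)
  thus ?thesis
  proof (induction rule: generate_ring.induct)
    case one
    show ?case using assms(2)[of 1] by simp
  next
    case (incl h)
    then show ?case using assms(2-4) by (auto elim: Ints_cases)
  qed (use assms(5-7) in \<open>simp_all add: biquadratic_ring_def\<close>)
qed

lemma biquadratic_ring_closed:
  "of_int k \<in> carrier (biquadratic_ring m n)"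
  "csqrt (of_int m) \<in> carrier (biquadratic_ring m n)"
  "csqrt (of_int n) \<in> carrier (biquadratic_ring m n)"
  "x \<in> carrier (biquadratic_ring m n) \<Longrightarrow> - x \<in> carrier (biquadratic_ring m n)"
  "x \<in> carrier (biquadratic_ring m n) \<Longrightarrow> y \<in> carrier (biquadratic_ring m n) \<Longrightarrow>
     x + y \<in> carrier (biquadratic_ring m n)"
  "x \<in> carrier (biquadratic_ring m n) \<Longrightarrow> y \<in> carrier (biquadratic_ring m n) \<Longrightarrow>
     x * y \<in> carrier (biquadratic_ring m n)"
  using generate_ring.incl[of _ _ complex_ring] generate_ring.a_inv[of _ complex_ring]
    generate_ring.eng_add[of _ complex_ring] generate_ring.eng_mult[of _ complex_ring]
  by (auto simp: biquadratic_ring_def)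

section \<open>Integer coordinates, and the absence of 1/2\<close>

text \<open>The integer combinations of 1, \<open>s\<close>, \<open>t\<close> and
  \<open>s * t\<close> contain the generators and are closed under products, since
  \<open>s * s\<close> and \<open>t * t\<close> are integers. Uniqueness of the coefficients is not
  claimed.\<close>

lemma biquadratic_ring_int_coeffs:
  assumes "x \<in> carrier (biquadratic_ring m n)"
  obtains a b c d :: int where
    "x = of_int a + of_int b * csqrt (of_int m) + of_int c * csqrt (of_int n)
       + of_int d * csqrt (of_int m) * csqrt (of_int n)"
proof -
  define s t where "s = csqrt (of_int m)" and "t = csqrt (of_int n)"
  have ss: "s * s = of_int m" and tt: "t * t = of_int n"
    by (simp_all add: s_def t_def flip: power2_eq_square)
  have "\<exists>a b c d :: int. x = of_int a + of_int b * s + of_int c * t + of_int d * s * t"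
    using assms
  proof (induction rule: biquadratic_ring_induct)
    case (int k)
    show ?case by (intro exI[of _ k] exI[of _ 0]) simp
  next
    case sqrt1
    show ?case by (rule exI[of _ 0], rule exI[of _ 1], intro exI[of _ 0]) (simp add: s_def)
  next
    case sqrt2
    show ?case
      by (rule exI[of _ 0], rule exI[of _ 0], rule exI[of _ 1], rule exI[of _ 0])
        (simp add: t_def)
  next
    case (add x y)
    then obtain a b c d a' b' c' d' :: int
      where "x = of_int a + of_int b * s + of_int c * t + of_int d * s * t"
        and "y = of_int a' + of_int b' * s + of_int c' * t + of_int d' * s * t"
      by blast
    then have "x + y = of_int (a + a') + of_int (b + b') * s + of_int (c + c') * t
      + of_int (d + d') * s * t"
      by (simp add: algebra_simps)
    thus ?case by blast
  next
    case (uminus x)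
    then obtain a b c d :: int
      where "x = of_int a + of_int b * s + of_int c * t + of_int d * s * t"
      by blast
    then have "- x = of_int (- a) + of_int (- b) * s + of_int (- c) * t + of_int (- d) * s * t"
      by (simp add: algebra_simps)
    thus ?case by blast
  next
    case (mult x y)
    then obtain a b c d a' b' c' d' :: int
      where "x = of_int a + of_int b * s + of_int c * t + of_int d * s * t"
        and "y = of_int a' + of_int b' * s + of_int c' * t + of_int d' * s * t"
      by blast
    then have "x * y = of_int (a * a' + b * b' * m + c * c' * n + d * d' * m * n)
        + of_int (a * b' + b * a' + (c * d' + d * c') * n) * s
        + of_int (a * c' + c * a' + (b * d' + d * b') * m) * t
        + of_int (a * d' + d * a' + b * c' + c * b') * s * t"
      \<comment> \<open>Writing \<open>m\<close> and \<open>n\<close> back as \<open>s * s\<close>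
        and \<open>t * t\<close> turns the claim into a polynomial identity.\<close>
      unfolding of_int_add of_int_mult ss[symmetric] tt[symmetric] by (simp add: algebra_simps)
    thus ?case by blast
  qed
  thus thesis using that by (auto simp: s_def t_def)
qed

text \<open>Parity replaces a comparison of coefficients: eliminating both roots from an expansion
  of 1/2 leaves an integer equation whose left side is odd, as \<open>(1 - 2 * a)\<^sup>2\<close> is
  odd and the other terms inside the square are even, and whose right side is divisible by
  16.\<close>

lemma half_notin_biquadratic_ring: "1 / 2 \<notin> carrier (biquadratic_ring m n)"
proof
  define s t where "s = csqrt (of_int m)" and "t = csqrt (of_int n)"
  have ss: "s\<^sup>2 = of_int m" and tt: "t\<^sup>2 = of_int n"
    by (simp_all add: s_def t_def)
  assume "1 / 2 \<in> carrier (biquadratic_ring m n)"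
  then obtain a b c d :: int
    where "1 / 2 = of_int a + of_int b * s + of_int c * t + of_int d * s * t"
    unfolding s_def t_def by (rule biquadratic_ring_int_coeffs)
  \<comment> \<open>All terms with \<open>t\<close> are put on one side, so that squaring turns
    \<open>t\<close> into \<open>n\<close>.\<close>
  hence "1 - 2 * of_int a - 2 * of_int b * s = 2 * (of_int c + of_int d * s) * t"
    by (simp add: field_simps)
  hence "(1 - 2 * of_int a - 2 * of_int b * s)\<^sup>2 = (2 * (of_int c + of_int d * s) * t)\<^sup>2"
    by simp
  also have "\<dots> = 4 * (of_int c + of_int d * s)\<^sup>2 * of_int n"
    by (simp only: power_mult_distrib tt) simp
  \<comment> \<open>\<open>\<surd>n\<close> is gone; collecting the terms with \<open>\<surd>m\<close> and squaring again eliminates \<open>\<surd>m\<close>.\<close>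
  finally have "(1 - 2 * of_int a)\<^sup>2 + 4 * (of_int b)\<^sup>2 * s\<^sup>2
      - 4 * of_int n * ((of_int c)\<^sup>2 + (of_int d)\<^sup>2 * s\<^sup>2)
      = 4 * s * ((1 - 2 * of_int a) * of_int b + 2 * of_int n * of_int c * of_int d)"
    by (simp add: power2_eq_square algebra_simps)
  hence "of_int ((1 - 2 * a)\<^sup>2 + 4 * b\<^sup>2 * m - 4 * n * (c\<^sup>2 + d\<^sup>2 * m))
      = 4 * s * of_int ((1 - 2 * a) * b + 2 * n * c * d)"
    by (simp add: ss)
  hence "(of_int ((1 - 2 * a)\<^sup>2 + 4 * b\<^sup>2 * m - 4 * n * (c\<^sup>2 + d\<^sup>2 * m)))\<^sup>2
      = (4 * s * of_int ((1 - 2 * a) * b + 2 * n * c * d))\<^sup>2"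
    by (rule arg_cong)
  also have "\<dots> = of_int (16 * m * ((1 - 2 * a) * b + 2 * n * c * d)\<^sup>2)"
    by (simp add: power_mult_distrib ss)
  finally have "((1 - 2 * a)\<^sup>2 + 4 * b\<^sup>2 * m - 4 * n * (c\<^sup>2 + d\<^sup>2 * m))\<^sup>2
      = 16 * m * ((1 - 2 * a) * b + 2 * n * c * d)\<^sup>2"
    by (simp only: of_int_power[symmetric] of_int_eq_iff)
  moreover have "odd (((1 - 2 * a)\<^sup>2 + 4 * b\<^sup>2 * m - 4 * n * (c\<^sup>2 + d\<^sup>2 * m))\<^sup>2)"
    by simp
  ultimately show False by simp
qed

section \<open>Nonzero endomorphisms and their values on the generators\<close>

lemma ring_endos_biquadratic_ringD:
  assumes "\<sigma> \<in> ring_endos (biquadratic_ring m n)"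
  shows "\<sigma> \<in> carrier (biquadratic_ring m n) \<rightarrow> carrier (biquadratic_ring m n)"
    and "\<And>x y. x \<in> carrier (biquadratic_ring m n) \<Longrightarrow> y \<in> carrier (biquadratic_ring m n) \<Longrightarrow>
      \<sigma> (x + y) = \<sigma> x + \<sigma> y"
    and "\<And>x y. x \<in> carrier (biquadratic_ring m n) \<Longrightarrow> y \<in> carrier (biquadratic_ring m n) \<Longrightarrow>
      \<sigma> (x * y) = \<sigma> x * \<sigma> y"
  using assms by (auto simp: ring_endos_def hom_def)

text \<open>Unitality is not part of \<open>ring_endos\<close>. It follows by cancelling a nonzero
  value \<sigma> x in \<sigma> x = \<sigma> 1 * \<sigma> x; additivity then reaches all
  integers.\<close>

lemma nonzero_endo_of_int:
  assumes \<sigma>: "\<sigma> \<in> ring_endos (biquadratic_ring m n)"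
    and "nonzero_on (biquadratic_ring m n) \<sigma>"
  shows "\<sigma> (of_int k) = of_int k"
proof -
  note hom = ring_endos_biquadratic_ringD[OF \<sigma>]
  note closed = biquadratic_ring_closed(1)[of _ m n]
  obtain x where "x \<in> carrier (biquadratic_ring m n)" "\<sigma> x \<noteq> 0"
    using assms(2) by (auto simp: nonzero_on_def)
  moreover have "\<sigma> x = \<sigma> 1 * \<sigma> x"
    using hom(3)[OF closed[of 1] calculation(1)] by simp
  ultimately have 1: "\<sigma> 1 = 1" by simp
  have 0: "\<sigma> 0 = 0"
    using hom(2)[OF closed[of 0] closed[of 0]] by simp
  have step: "\<sigma> (of_int (i + 1)) = \<sigma> (of_int i) + 1" for i
    using hom(2)[OF closed[of i] closed[of 1]] 1 by simp
  show ?thesis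
  proof (induction k rule: int_induct[where k = 0])
    case base
    show ?case using 0 by simp
  next
    case (step1 i)
    then show ?case using step[of i] by simp
  next
    case (step2 i)
    then show ?case using step[of "i - 1"] by (simp add: eq_diff_eq)
  qed
qed

text \<open>As the integer \<open>s\<^sup>2\<close> is fixed, \<sigma> s has the same square as
  \<open>s\<close>.\<close>

lemma nonzero_endo_sqrt:
  assumes \<sigma>: "\<sigma> \<in> ring_endos (biquadratic_ring m n)"
    and nz: "nonzero_on (biquadratic_ring m n) \<sigma>"
    and s: "s \<in> carrier (biquadratic_ring m n)" "s\<^sup>2 = of_int k"
  shows "\<sigma> s = s \<or> \<sigma> s = - s"
proof -
  have "(\<sigma> s)\<^sup>2 = \<sigma> (s\<^sup>2)"
    using ring_endos_biquadratic_ringD(3)[OF \<sigma> s(1) s(1)] by (simp add: power2_eq_square)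
  also have "\<dots> = s\<^sup>2"
    using nonzero_endo_of_int[OF \<sigma> nz] s(2) by simp
  finally show ?thesis by (simp add: power2_eq_iff)
qed

text \<open>This makes the halved difference a map into the ring. On integers the difference
  vanishes, on a root \<open>s\<close> its half is 0, \<open>s\<close> or \<open>- s\<close>, and
  the property survives the ring operations.\<close>

lemma half_diff_in_biquadratic_ring:
  assumes \<sigma>: "\<sigma> \<in> ring_endos (biquadratic_ring m n)" "nonzero_on (biquadratic_ring m n) \<sigma>"
    and \<tau>: "\<tau> \<in> ring_endos (biquadratic_ring m n)" "nonzero_on (biquadratic_ring m n) \<tau>"
    and x: "x \<in> carrier (biquadratic_ring m n)"
  shows "(\<tau> x - \<sigma> x) / 2 \<in> carrier (biquadratic_ring m n)"
proof -
  note homs = ring_endos_biquadratic_ringD[OF \<sigma>(1)] ring_endos_biquadratic_ringD[OF \<tau>(1)]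
  note closed = biquadratic_ring_closed[where m = m and n = n]
  have zero: "0 \<in> carrier (biquadratic_ring m n)" using closed(1)[of 0] by simp
  have sqrt: "(\<tau> s - \<sigma> s) / 2 \<in> carrier (biquadratic_ring m n)"
    if "s \<in> carrier (biquadratic_ring m n)" "s\<^sup>2 = of_int k" for s k
    using nonzero_endo_sqrt[OF \<sigma> that] nonzero_endo_sqrt[OF \<tau> that] that(1) closed(4)[of s] zero
    by auto
  show ?thesis
    using x
  proof (induction rule: biquadratic_ring_induct)
    case (int k)
    show ?case using nonzero_endo_of_int[OF \<sigma>] nonzero_endo_of_int[OF \<tau>] zero by simp
  next
    case sqrt1
    show ?case by (rule sqrt[OF closed(2)]) simp
  next
    case sqrt2
    show ?case by (rule sqrt[OF closed(3)]) simp
  next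
    case (add x y)
    have "(\<tau> (x + y) - \<sigma> (x + y)) / 2 = (\<tau> x - \<sigma> x) / 2 + (\<tau> y - \<sigma> y) / 2"
      using add by (simp add: homs field_simps)
    with closed(5)[OF add(3,4)] show ?case by (simp only:)
  next
    case (uminus x)
    have neg: "\<phi> (- x) = - \<phi> x" if "\<phi> \<in> ring_endos (biquadratic_ring m n)"
      "nonzero_on (biquadratic_ring m n) \<phi>" for \<phi>
      using ring_endos_biquadratic_ringD(2)[OF that(1) uminus(1) closed(4)[OF uminus(1)]]
        nonzero_endo_of_int[OF that, of 0]
      by (simp add: add_eq_0_iff)
    have "(\<tau> (- x) - \<sigma> (- x)) / 2 = - ((\<tau> x - \<sigma> x) / 2)"
      by (simp add: neg[OF \<sigma>] neg[OF \<tau>] field_simps)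
    with closed(4)[OF uminus(2)] show ?case by (simp only:)
  next
    case (mult x y)
    \<comment> \<open>This is the twisted product rule for the halved difference: adding and
      subtracting \<sigma> x * \<tau> y keeps each factor 1/2 attached to a difference covered by
      the induction.\<close>
    have "(\<tau> (x * y) - \<sigma> (x * y)) / 2 = (\<tau> x - \<sigma> x) / 2 * \<tau> y + \<sigma> x * ((\<tau> y - \<sigma> y) / 2)"
      using mult by (simp add: homs field_simps)
    moreover have "\<tau> y \<in> carrier (biquadratic_ring m n)" "\<sigma> x \<in> carrier (biquadratic_ring m n)"
      using mult homs(1,4) by auto
    ultimately show ?case
      using closed(5)[OF closed(6)[OF mult(3)] closed(6)[OF _ mult(4)]] by (simp only:)
  qed
qed

section \<open>The halved difference as a derivation that is not inner\<close>

theorem corollary3p24: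
  fixes m n :: int and \<sigma> \<tau> :: "complex \<Rightarrow> complex"
  assumes "m \<noteq> n" and "squarefree m" and "squarefree n"
    and "ring.dimension complex_ring 4 \<rat> (biquadratic_field m n)"
    and "\<sigma> \<in> ring_endos (biquadratic_ring m n)"
    and "\<tau> \<in> ring_endos (biquadratic_ring m n)"
    and "nonzero_on (biquadratic_ring m n) \<sigma>"
    and "nonzero_on (biquadratic_ring m n) \<tau>"
    and "\<exists>x\<in>carrier (biquadratic_ring m n). \<sigma> x \<noteq> \<tau> x"
  shows "carrier (Out (biquadratic_ring m n) \<sigma> \<tau>)
           \<noteq> {\<one>\<^bsub>Out (biquadratic_ring m n) \<sigma> \<tau>\<^esub>}"
proof -
  note homs = ring_endos_biquadratic_ringD[OF assms(5)] ring_endos_biquadratic_ringD[OF assms(6)]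
  note closed = biquadratic_ring_closed[where m = m and n = n]
  interpret R: ring "biquadratic_ring m n" by (rule ring_biquadratic_ring)
  \<comment> \<open>Over the complex numbers this map would be inner with \<beta> = 1/2, so only the
    missing 1/2 can make it outer. The restricted abstraction gives the extensionality that
    \<open>twisted_derivations\<close> demands.\<close>
  define D where "D = (\<lambda>x\<in>carrier (biquadratic_ring m n). (\<tau> x - \<sigma> x) / 2)"
  have "D \<in> carrier (biquadratic_ring m n) \<rightarrow>\<^sub>E carrier (biquadratic_ring m n)"
    using half_diff_in_biquadratic_ring[OF assms(5,7,6,8)] by (auto simp: D_def)
  hence "D \<in> twisted_derivations (biquadratic_ring m n) \<sigma> \<tau>"
    unfolding R.twisted_derivations_iff
    by (simp add: D_def homs closed(5,6) field_simps)
  moreover have "D \<notin> inner_derivations (biquadratic_ring m n) \<sigma> \<tau>"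
  proof
    assume "D \<in> inner_derivations (biquadratic_ring m n) \<sigma> \<tau>"
    then obtain \<beta> where \<beta>: "\<beta> \<in> carrier (biquadratic_ring m n)"
      and D: "\<And>x. x \<in> carrier (biquadratic_ring m n) \<Longrightarrow>
        D x = \<beta> * \<tau> x \<ominus>\<^bsub>biquadratic_ring m n\<^esub> \<sigma> x * \<beta>"
      by (auto simp: inner_derivations_def)
    obtain x where x: "x \<in> carrier (biquadratic_ring m n)" "\<sigma> x \<noteq> \<tau> x"
      using assms(9) by blast
    have "\<beta> * \<tau> x \<in> carrier (biquadratic_ring m n)" "\<sigma> x * \<beta> \<in> carrier (biquadratic_ring m n)"
      using x(1) \<beta> homs(1,4) closed(6) by auto
    hence "(\<tau> x - \<sigma> x) / 2 = \<beta> * \<tau> x - \<sigma> x * \<beta>"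
      using D[OF x(1)] x(1) by (simp add: biquadratic_ring_minus D_def)
    \<comment> \<open>By commutativity the inner formula is a multiple of \<tau> x - \<sigma> x,
      which is nonzero at this \<open>x\<close> and cancels.\<close>
    hence "(\<tau> x - \<sigma> x) * (1 / 2) = (\<tau> x - \<sigma> x) * \<beta>"
      by (simp add: algebra_simps)
    hence "\<beta> = 1 / 2"
      using x(2) by (metis mult_left_cancel right_minus_eq)
    with \<beta> half_notin_biquadratic_ring show False by simp
  qed
  ultimately show ?thesis
    by (rule R.Out_nontrivial[OF homs(1,4)])
qed

end
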